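(* Let $T$ be an invertible ergodic measure preserving transformation on a Lebesgue probability space $(X,\mathcal{B},\mu)$ and let $\epsilon>0$. Then $T$ has $\epsilon$-over-recurrent sets of arbitrarily small measure; that is, for every $\delta>0$ there exists a measurable set $A$ with $0<\mu(A)<1$ and $\mu(A)<\delta$ such that $$\mu(T^nA\cap A)>(1-\epsilon)\mu(A)^2\quad\text{for all } n\in\mathbb{Z}.$$
   Context: A Lebesgue probability space is a (non-atomic) standard probability space, i.e. isomorphic mod null sets to $[0,1]$ with Lebesgue measure. A measurable set $A$ with $0<\mu(A)<1$ is $\epsilon$-over-recurrent for $T$ if $\mu(T^nA\cap A)>(1-\epsilon)\mu(A)^2$ for all $n\in\mathbb{Z}$. *)

theory Defs
  imports "HOL-Probability.Probability"
begin

definition isomorphic_mod_null :: "'a measure \<Rightarrow> 'b measure \<Rightarrow> bool" where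
  "isomorphic_mod_null M N \<longleftrightarrow>
    (\<exists>X0 Y0 f. X0 \<in> sets M \<and> space M - X0 \<in> null_sets M \<and>
               Y0 \<in> sets N \<and> space N - Y0 \<in> null_sets N \<and>
               bij_betw f X0 Y0 \<and>
               f \<in> restrict_space M X0 \<rightarrow>\<^sub>M restrict_space N Y0 \<and>
               the_inv_into X0 f \<in> restrict_space N Y0 \<rightarrow>\<^sub>M restrict_space M X0 \<and>
               distr (restrict_space M X0) (restrict_space N Y0) f = restrict_space N Y0)"

(* Passing to the completion covers both conventions: it is the identity on a complete space,
   and it also admits standard Borel spaces, such as the Borel sets of the unit interval.
   Non-atomicity follows from the isomorphism. *)
definition lebesgue_probability_space :: "'a measure \<Rightarrow> bool" where
  "lebesgue_probability_space M \<longleftrightarrow>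
    prob_space M \<and> isomorphic_mod_null (completion M) (lebesgue_on {0..1::real})"

(* Invertibility is understood mod null sets: T restricts to a bimeasurable bijection of a
   conull set onto itself.  An everywhere bijective bimeasurable T has X0 = space M. *)
definition invertible_mpt :: "'a measure \<Rightarrow> ('a \<Rightarrow> 'a) \<Rightarrow> bool" where
  "invertible_mpt M T \<longleftrightarrow>
    T \<in> M \<rightarrow>\<^sub>M M \<and> distr M M T = M \<and>
    (\<exists>X0 \<in> sets M. space M - X0 \<in> null_sets M \<and> bij_betw T X0 X0 \<and>
       the_inv_into X0 T \<in> restrict_space M X0 \<rightarrow>\<^sub>M restrict_space M X0)"

definition ergodic :: "'a measure \<Rightarrow> ('a \<Rightarrow> 'a) \<Rightarrow> bool" where
  "ergodic M T \<longleftrightarrow>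
    (\<forall>A \<in> sets M. T -` A \<inter> space M = A \<longrightarrow> measure M A = 0 \<or> measure M A = 1)"

(* The set T^n A: a forward image for n \<ge> 0, a preimage for n < 0. *)
definition int_iterate :: "'a measure \<Rightarrow> ('a \<Rightarrow> 'a) \<Rightarrow> int \<Rightarrow> 'a set \<Rightarrow> 'a set" where
  "int_iterate M T n A =
    (if n \<ge> 0 then (T ^^ nat n) ` A else (T ^^ nat (- n)) -` A \<inter> space M)"

(* Measurability of T^n A is automatic when T is everywhere bijective; it is demanded here
   because T may send a measurable null set to a non-measurable set when T is invertible
   only mod null sets. *)
definition over_recurrent :: "'a measure \<Rightarrow> ('a \<Rightarrow> 'a) \<Rightarrow> real \<Rightarrow> 'a set \<Rightarrow> bool" where
  "over_recurrent M T \<epsilon> A \<longleftrightarrow>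
    A \<in> sets M \<and> 0 < measure M A \<and> measure M A < 1 \<and>
    (\<forall>n::int. int_iterate M T n A \<in> sets M \<and>
       measure M (int_iterate M T n A \<inter> A) > (1 - \<epsilon>) * (measure M A)\<^sup>2)"

end

theory Submission
  imports Defs "HOL-Number_Theory.Cong"
begin

text \<open>
  Let \<open>C\<close> be a set of tiny positive measure and let \<open>\<tau>\<close> be the first time at which an orbit
  enters \<open>C\<close>; by ergodicity \<open>\<tau>\<close> is finite almost everywhere. As long as an orbit avoids \<open>C\<close>,
  the function \<open>\<tau>\<close> simply counts down by one at every step. Define \<open>A = {x. P (\<tau> x)}\<close> for a
  predicate \<open>P\<close> on the natural numbers with period \<open>N\<close>. By invariance of the measure,
  \<open>N \<mu>(A \<inter> T\<^sup>-\<^sup>m A)\<close> is the average over \<open>x\<close> of the number of \<open>i < N\<close> for which both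
  \<open>T\<^sup>i x\<close> and \<open>T\<^sup>i (T\<^sup>m x)\<close> lie in \<open>A\<close>. If \<open>C\<close> is small compared with \<open>1 / N\<close>, then for
  most \<open>x\<close> neither orbit meets \<open>C\<close> during this window, whatever \<open>m\<close> is, and the number
  counts the \<open>n\<close> in a full period with \<open>P (n + a)\<close> and \<open>P (n + b)\<close> for some \<open>a\<close> and \<open>b\<close>.
  The infinitely many conditions on \<open>A\<close> thus reduce to the finitely many cyclic correlations
  of \<open>P\<close> (lemma \<open>hitting_time_set_bounds\<close>).

  What remains is to find a periodic \<open>P\<close> of small density \<open>d\<close>, all of whose correlations
  have density at least \<open>(1 - \<eta>) d\<^sup>2\<close> (lemma
  \<open>sparse_periodic_set_with_large_correlations\<close>). Deleting a proportion \<open>t\<close> of the residues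
  modulo \<open>M\<close> leaves density \<open>1 - t\<close>, and two translates meet in density at least
  \<open>1 - 2 t = (1 - t)\<^sup>2 - t\<^sup>2\<close>: the relative loss of correlation is of second order in \<open>t\<close>,
  whereas the density drops to first order. For pairwise coprime moduli both densities multiply,
  by the Chinese remainder theorem. A sieve with about \<open>q / t\<close> such moduli therefore has density
  about \<open>exp (- q)\<close> and relative loss only about \<open>q t\<close>, which is small once \<open>t\<close> is
  small compared with \<open>1 / q\<close>.

  Forward images are measurable once \<open>A\<close> is cut down to the conull set on which \<open>T\<close> is a
  bimeasurable bijection.
\<close>

section \<open>Sparse periodic sets with nearly independent translates\<close>

lemma card_periodic_shift:
  assumes "\<And>n. P (n + N) = P n"
  shows "card {n. n < N \<and> P (n + a)} = card {n::nat. n < N \<and> P n}"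
proof (induction a)
  case (Suc a)
  let ?f = "\<lambda>n. of_bool (P (n + a)) :: nat"
  have card_eq: "card {n. n < N \<and> R n} = (\<Sum>n<N. of_bool (R n))" for R
    by (auto simp: of_bool_def sum.If_cases intro!: arg_cong[where f = card])
  have "?f 0 + (\<Sum>n<N. ?f (Suc n)) = (\<Sum>n<Suc N. ?f n)"
    by (rule sum.lessThan_Suc_shift[symmetric])
  also have "\<dots> = (\<Sum>n<N. ?f n) + ?f N"
    by simp
  also have "?f N = ?f 0"
    using assms[of a] by (simp add: add.commute)
  finally have "(\<Sum>n<N. ?f (Suc n)) = (\<Sum>n<N. ?f n)"
    by simp
  then show ?case
    using Suc by (simp add: card_eq)
qed simp

lemma periodic_mod:
  assumes "\<And>n. P (n + N) = P n"
  shows "P (n mod N) = P (n::nat)"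
proof -
  have "P (m + k * N) = P m" for m k
  proof (induction k)
    case (Suc k)
    then show ?case
      using assms[of "m + k * N"] by (simp add: add_ac)
  qed simp
  from this[of "n mod N" "n div N"] show ?thesis
    by simp
qed

text \<open>
  The Chinese remainder theorem in probabilistic form: for coprime periods, \<open>P\<close> and \<open>Q\<close> are
  independent over a common period.
\<close>

lemma card_coprime_periodic:
  fixes N M :: nat
  assumes "coprime N M" "N > 0" "M > 0"
    and P: "\<And>n. P (n + N) = P n" and Q: "\<And>n. Q (n + M) = Q n"
  shows "card {n. n < N * M \<and> P n \<and> Q n} = card {n. n < N \<and> P n} * card {n. n < M \<and> Q n}"
proof -
  let ?A = "{n. n < N * M \<and> P n \<and> Q n}" and ?B = "{n. n < N \<and> P n} \<times> {n. n < M \<and> Q n}"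
  let ?f = "\<lambda>n. (n mod N, n mod M)"
  have "inj_on ?f ?A"
  proof (rule inj_onI)
    fix x y assume "x \<in> ?A" "y \<in> ?A" and eq: "?f x = ?f y"
    then have "x < N * M" "y < N * M" by auto
    moreover have "[x = y] (mod N * M)"
      using eq assms(1) by (intro coprime_cong_mult_nat) (auto simp: cong_def)
    ultimately show "x = y"
      by (simp add: cong_def)
  qed
  moreover have "?f ` ?A = ?B"
  proof (intro equalityI subsetI)
    fix z assume "z \<in> ?f ` ?A"
    then show "z \<in> ?B"
      using assms(2,3) periodic_mod[of P N, OF P] periodic_mod[of Q M, OF Q] by auto
  next
    fix z assume "z \<in> ?B"
    then obtain a b where z: "z = (a, b)" "a < N" "P a" "b < M" "Q b" by auto
    obtain x where x: "x < N * M" "[x = a] (mod N)" "[x = b] (mod M)"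
      using binary_chinese_remainder_unique_nat[OF assms(1), of a b] assms(2,3) by auto
    then have "x mod N = a" "x mod M = b"
      using z by (auto simp: cong_def)
    then show "z \<in> ?f ` ?A"
      using x z periodic_mod[of P N x, OF P] periodic_mod[of Q M x, OF Q]
      by (intro image_eqI[of _ _ x]) auto
  qed
  ultimately have "card ?A = card ?B"
    using card_image[of ?f ?A] by simp
  then show ?thesis
    by (simp add: card_cartesian_product)
qed

text \<open>
  Each translate loses only \<open>r\<close> residues, so a union bound suffices; the result falls short of
  the square of the density by second order only.
\<close>

lemma card_two_translates_avoiding:
  fixes M r :: nat
  assumes "r \<le> M" "M > 0"
  shows "M - 2 * r \<le> card {n. n < M \<and> r \<le> (n + a) mod M \<and> r \<le> (n + b) mod M}"
proof -
  let ?X = "\<lambda>a. {n. n < M \<and> (n + a) mod M < r}"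
  have "card (?X a) = r" for a
  proof -
    have "card (?X a) = card {n. n < M \<and> n mod M < r}"
      by (rule card_periodic_shift[of "\<lambda>n. n mod M < r"]) simp
    also have "{n. n < M \<and> n mod M < r} = {..<r}"
      using assms by auto
    finally show ?thesis by simp
  qed
  then have "card (?X a \<union> ?X b) \<le> 2 * r"
    using card_Un_le[of "?X a" "?X b"] by simp
  moreover have "{n. n < M \<and> r \<le> (n + a) mod M \<and> r \<le> (n + b) mod M} = {..<M} - (?X a \<union> ?X b)"
    by auto
  moreover have "card ({..<M} - (?X a \<union> ?X b)) = M - card (?X a \<union> ?X b)"
    by (subst card_Diff_subset) auto
  ultimately show ?thesis by simp
qed

text \<open>
  Each step multiplies the period \<open>N\<close> by \<open>M = (l + 1) N + 1\<close> and deletes \<open>N\<close> residue classes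
  modulo \<open>M\<close>. This \<open>M\<close> is coprime to \<open>N\<close> by construction, and \<open>N / M\<close> is close to
  \<open>1 / (l + 1)\<close>, so that all steps delete nearly the same proportion.
\<close>

lemma periodic_set_iterated_sieve:
  fixes l k :: nat
  assumes "l > 0"
  shows "\<exists>N P. N > 0 \<and> (\<forall>n. P (n + N) = P n) \<and> card {n. n < N \<and> P n} > 0 \<and>
    real (card {n. n < N \<and> P n}) \<le> (real (l + 1) / real (l + 2)) ^ k * real N \<and>
    (\<forall>a b. (1 - 1 / (real l)\<^sup>2) ^ k * (real (card {n. n < N \<and> P n}))\<^sup>2
            \<le> real (card {n. n < N \<and> P (n + a) \<and> P (n + b)}) * real N)"
proof (induction k)
  case 0
  show ?case
    by (intro exI[of _ 1] exI[of _ "\<lambda>_. True"]) simp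
next
  case (Suc k)
  define \<rho> where "\<rho> = 1 - 1 / (real l)\<^sup>2"
  have \<rho>: "\<rho> \<ge> 0"
    using assms by (simp add: \<rho>_def)
  from Suc obtain N P where N: "N > 0" and per: "\<And>n. P (n + N) = P n"
    and pos: "card {n. n < N \<and> P n} > 0"
    and dens: "real (card {n. n < N \<and> P n}) \<le> (real (l + 1) / real (l + 2)) ^ k * real N"
    and corr: "\<And>a b. \<rho> ^ k * (real (card {n. n < N \<and> P n}))\<^sup>2
            \<le> real (card {n. n < N \<and> P (n + a) \<and> P (n + b)}) * real N"
    unfolding \<rho>_def by blast
  define M where "M = (l + 1) * N + 1"
  define Q where "Q = (\<lambda>n. N \<le> n mod M)"
  define s where "s = card {n. n < N \<and> P n}"
  have M: "M > 0" "N \<le> M"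
    by (auto simp: M_def)
  have cop: "coprime N M"
  proof (rule coprimeI)
    fix c assume "c dvd N" "c dvd M"
    then show "is_unit c"
      using dvd_add_right_iff[of c "(l + 1) * N" 1] by (simp add: M_def)
  qed
  have perQ: "\<And>n. Q (n + M) = Q n"
    by (simp add: Q_def)
  have "{n. n < M \<and> Q n} = {N..<M}"
    by (auto simp: Q_def)
  then have cardQ: "card {n. n < M \<and> Q n} = l * N + 1"
    by (simp add: M_def)
  have s': "card {n. n < N * M \<and> P n \<and> Q n} = s * (l * N + 1)"
    using card_coprime_periodic[of N M P Q, OF cop N M(1) per perQ] cardQ by (simp add: s_def)
  have "card {n. n < N * M \<and> P n \<and> Q n} > 0"
    using pos by (simp add: s' s_def)
  moreover have "real (card {n. n < N * M \<and> P n \<and> Q n})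
      \<le> (real (l + 1) / real (l + 2)) ^ Suc k * real (N * M)"
  proof -
    have "real (l * N + 1) * real (l + 2) \<le> real (l + 1) * real M"
      unfolding M_def of_nat_mult[symmetric] of_nat_le_iff using N by (simp add: algebra_simps)
    then have "real (l * N + 1) \<le> real (l + 1) / real (l + 2) * real M"
      by (simp add: field_simps)
    then have "real s * real (l * N + 1)
        \<le> ((real (l + 1) / real (l + 2)) ^ k * real N) * (real (l + 1) / real (l + 2) * real M)"
      using dens unfolding s_def by (intro mult_mono) auto
    then show ?thesis
      unfolding s' of_nat_mult power_Suc by (simp only: mult_ac)
  qed
  moreover have "\<rho> ^ Suc k * (real (card {n. n < N * M \<and> P n \<and> Q n}))\<^sup>2
      \<le> real (card {n. n < N * M \<and> (P (n + a) \<and> Q (n + a)) \<and> (P (n + b) \<and> Q (n + b))})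
        * real (N * M)" for a b
  proof -
    define c where "c = card {n. n < N \<and> P (n + a) \<and> P (n + b)}"
    define e where "e = card {n. n < M \<and> Q (n + a) \<and> Q (n + b)}"
    have "card {n. n < N * M \<and> (P (n + a) \<and> P (n + b)) \<and> (Q (n + a) \<and> Q (n + b))} = c * e"
      unfolding c_def e_def
      by (rule card_coprime_periodic[OF cop N M(1)])
        (use per[of "_ + a"] per[of "_ + b"] perQ[of "_ + a"] perQ[of "_ + b"]
          in \<open>auto simp: add_ac\<close>)
    moreover have "{n. n < N * M \<and> (P (n + a) \<and> Q (n + a)) \<and> (P (n + b) \<and> Q (n + b))}
        = {n. n < N * M \<and> (P (n + a) \<and> P (n + b)) \<and> (Q (n + a) \<and> Q (n + b))}"
      by auto
    ultimately have ce: "card {n. n < N * M \<and> (P (n + a) \<and> Q (n + a)) \<and> (P (n + b) \<and> Q (n + b))}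
        = c * e"
      by simp
    have "M - 2 * N \<le> e"
      using card_two_translates_avoiding[OF M(2,1), of a b] by (simp add: e_def Q_def)
    then have e: "real M - 2 * real N \<le> real e"
      by linarith
    \<comment> \<open>The remaining proportion exceeds the deleted one by a factor of at least \<open>l\<close>, so
       \<open>(M - 2 N) M = (M - N)\<^sup>2 - N\<^sup>2\<close> loses at most the fraction \<open>1 / l\<^sup>2\<close>.\<close>
    have "(real l * real N)\<^sup>2 \<le> (real (l * N + 1))\<^sup>2"
      by (intro power_mono) auto
    then have "(real N)\<^sup>2 \<le> (real (l * N + 1))\<^sup>2 / (real l)\<^sup>2"
      using assms by (simp add: field_simps power_mult_distrib)
    then have "\<rho> * (real (l * N + 1))\<^sup>2 \<le> (real (l * N + 1))\<^sup>2 - (real N)\<^sup>2"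
      by (simp add: \<rho>_def algebra_simps)
    also have "\<dots> = (real M - 2 * real N) * real M"
      by (simp add: M_def power2_eq_square algebra_simps)
    also have "\<dots> \<le> real e * real M"
      using e by (intro mult_right_mono) auto
    finally have "\<rho> * (real (l * N + 1))\<^sup>2 \<le> real e * real M" .
    then have "(\<rho> ^ k * (real s)\<^sup>2) * (\<rho> * (real (l * N + 1))\<^sup>2)
        \<le> (real c * real N) * (real e * real M)"
      using corr[of a b] \<rho> unfolding s_def[symmetric] c_def[symmetric]
      by (intro mult_mono[of "_ * _" "_ * _" "_ * _" "_ * _"]) auto
    then show ?thesis
      unfolding ce s' of_nat_mult power_mult_distrib power_Suc by (simp only: mult_ac)
  qed
  moreover have "\<forall>n. (P (n + N * M) \<and> Q (n + N * M)) = (P n \<and> Q n)"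
  proof
    fix n
    have "P (n + N * M) = P n"
      using periodic_mod[of P N "n + N * M", OF per] periodic_mod[of P N n, OF per] by simp
    moreover have "Q (n + N * M) = Q n"
      by (simp add: Q_def)
    ultimately show "(P (n + N * M) \<and> Q (n + N * M)) = (P n \<and> Q n)"
      by simp
  qed
  moreover have "N * M > 0"
    using N M by simp
  ultimately show ?case
    unfolding \<rho>_def by (intro exI[of _ "N * M"] exI[of _ "\<lambda>n. P n \<and> Q n"]) blast
qed

lemma sparse_periodic_set_with_large_correlations:
  fixes \<delta> \<eta> :: real
  assumes "\<delta> > 0" "\<eta> > 0"
  obtains N :: nat and P where "N > 0" "\<And>n. P (n + N) = P n" "card {n. n < N \<and> P n} > 0"
    "real (card {n. n < N \<and> P n}) < \<delta> * real N"
    "\<And>a b. (1 - \<eta>) * (real (card {n. n < N \<and> P n}))\<^sup>2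
            \<le> real (card {n. n < N \<and> P (n + a) \<and> P (n + b)}) * real N"
proof -
  \<comment> \<open>After \<open>l q\<close> sieving steps the density is at most \<open>exp (- q / 3)\<close> and the relative loss
     at most \<open>q / l\<close>; first \<open>q\<close> is fixed by \<open>\<delta>\<close>, then \<open>l\<close> by \<open>q\<close> and \<open>\<eta>\<close>.\<close>
  obtain q :: nat where q: "- 3 * ln \<delta> < real q"
    using reals_Archimedean2 by blast
  obtain l0 :: nat where l0: "real q / \<eta> < real l0"
    using reals_Archimedean2 by blast
  define l where "l = Suc l0"
  define k where "k = l * q"
  have l: "l > 0" "real q / \<eta> < real l"
    using l0 by (auto simp: l_def)
  from periodic_set_iterated_sieve[OF l(1), of k] obtain N P where
    N: "N > 0" and per: "\<And>n. P (n + N) = P n" and pos: "card {n. n < N \<and> P n} > 0"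
    and dens: "real (card {n. n < N \<and> P n}) \<le> (real (l + 1) / real (l + 2)) ^ k * real N"
    and corr: "\<And>a b. (1 - 1 / (real l)\<^sup>2) ^ k * (real (card {n. n < N \<and> P n}))\<^sup>2
            \<le> real (card {n. n < N \<and> P (n + a) \<and> P (n + b)}) * real N"
    by blast
  have "(real (l + 1) / real (l + 2)) ^ k \<le> exp (- 1 / real (l + 2)) ^ k"
    using exp_ge_add_one_self[of "- 1 / real (l + 2)"]
    by (intro power_mono) (auto simp: field_simps)
  also have "\<dots> = exp (- (real k / real (l + 2)))"
    by (simp flip: exp_of_nat_mult)
  also have "\<dots> \<le> exp (- (real q / 3))"
  proof -
    have "real q * (l + 2) \<le> real q * (3 * l)"
      using l by (intro mult_left_mono) auto
    then show ?thesis
      by (simp add: k_def field_simps)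
  qed
  also have "\<dots> < exp (ln \<delta>)"
    using q by (subst exp_less_cancel_iff) linarith
  also have "\<dots> = \<delta>"
    using assms(1) by simp
  finally have "(real (l + 1) / real (l + 2)) ^ k * real N < \<delta> * real N"
    using N by simp
  then have 1: "real (card {n. n < N \<and> P n}) < \<delta> * real N"
    using dens by linarith
  have "1 - \<eta> \<le> 1 - real q / real l"
    using l assms(2) by (simp add: field_simps)
  also have "\<dots> = 1 + real k * (- (1 / (real l)\<^sup>2))"
    using l by (simp add: k_def power2_eq_square)
  also have "\<dots> \<le> (1 + - (1 / (real l)\<^sup>2)) ^ k"
    using l by (intro Bernoulli_inequality) auto
  finally have "1 - \<eta> \<le> (1 - 1 / (real l)\<^sup>2) ^ k"
    by simp
  then have 2: "(1 - \<eta>) * (real (card {n. n < N \<and> P n}))\<^sup>2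
      \<le> real (card {n. n < N \<and> P (n + a) \<and> P (n + b)}) * real N" for a b
    using corr[of a b] by (meson mult_right_mono order_trans zero_le_power2)
  show ?thesis
    using that[OF N per pos 1 2] .
qed

section \<open>Averages of a measure preserving map over a window of iterates\<close>

lemma measurable_funpow:
  assumes "T \<in> M \<rightarrow>\<^sub>M M"
  shows "T ^^ n \<in> M \<rightarrow>\<^sub>M M"
proof (induction n)
  case (Suc n)
  show ?case
    unfolding funpow.simps by (rule measurable_comp[OF Suc assms])
qed simp

lemma distr_funpow:
  assumes "T \<in> M \<rightarrow>\<^sub>M M" "distr M M T = M"
  shows "distr M M (T ^^ n) = M"
proof (induction n)
  case (Suc n)
  have "distr M M (T ^^ Suc n) = distr (distr M M (T ^^ n)) M T"
    unfolding funpow.simps by (rule distr_distr[OF assms(1) measurable_funpow[OF assms(1)], symmetric])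
  then show ?case
    unfolding Suc assms(2) .
qed (simp add: id_def)

lemma measure_vimage_funpow:
  assumes "T \<in> M \<rightarrow>\<^sub>M M" "distr M M T = M" "A \<in> sets M"
  shows "measure M ((T ^^ n) -` A \<inter> space M) = measure M A"
  using measure_distr[OF measurable_funpow[OF assms(1)] assms(3), of n] distr_funpow[OF assms(1,2)]
  by simp

lemma funpow_in_space:
  assumes "T \<in> M \<rightarrow>\<^sub>M M" "x \<in> space M"
  shows "(T ^^ n) x \<in> space M"
  using measurable_space[OF measurable_funpow[OF assms(1)] assms(2)] .

context prob_space
begin

text \<open>
  The set of points that visit \<open>C\<close> contains its preimage but need not equal it. Ergodicity
  speaks of strictly invariant sets, so it is applied to the points that visit \<open>C\<close>
  infinitely often: this set is the decreasing intersection of preimages of equal measure.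
\<close>

lemma ergodic_AE_hits:
  assumes T: "T \<in> M \<rightarrow>\<^sub>M M" "distr M M T = M" and erg: "ergodic M T"
    and C: "C \<in> events" "prob C > 0"
  shows "AE x in M. \<exists>j. (T ^^ j) x \<in> C"
proof -
  note [measurable] = measurable_funpow[OF T(1)] C(1)
  define U where "U = {x \<in> space M. \<exists>j. (T ^^ j) x \<in> C}"
  have U: "U \<in> events"
    unfolding U_def by measurable
  define V where "V n = (T ^^ n) -` U \<inter> space M" for n
  have V: "V n \<in> events" "prob (V n) = prob U" for n
    using U measure_vimage_funpow[OF T U] unfolding V_def by (auto intro: measurable_sets)
  have step: "V (Suc n) \<subseteq> V n" for n
  proof
    fix x assume x: "x \<in> V (Suc n)"
    then obtain j where "(T ^^ j) ((T ^^ Suc n) x) \<in> C"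
      by (auto simp: V_def U_def)
    then have "(T ^^ Suc j) ((T ^^ n) x) \<in> C"
      by (simp add: funpow_swap1)
    then show "x \<in> V n"
      using x funpow_in_space[OF T(1)] unfolding V_def U_def by blast
  qed
  define W where "W = (\<Inter>n. V n)"
  have W: "W \<in> events"
    unfolding W_def using V by auto
  have "(\<lambda>n. prob (V n)) \<longlonglongrightarrow> prob W"
    unfolding W_def using V step by (intro finite_Lim_measure_decseq decseq_SucI) auto
  then have "prob W = prob U"
    unfolding V(2) by (simp add: LIMSEQ_const_iff)
  moreover have "prob C \<le> prob U"
  proof (rule finite_measure_mono[OF _ U])
    show "C \<subseteq> U"
      using sets.sets_into_space[OF C(1)] by (auto simp: U_def intro: exI[of _ 0])
  qed
  moreover have "T -` W \<inter> space M = W"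
  proof -
    have "T -` V n \<inter> space M = V (Suc n)" for n
      using measurable_space[OF T(1)] by (auto simp: V_def funpow_swap1)
    moreover have "T -` W \<inter> space M = (\<Inter>n. T -` V n \<inter> space M)"
      unfolding W_def by auto
    ultimately have "T -` W \<inter> space M = (\<Inter>n. V (Suc n))"
      by simp
    also have "\<dots> = W"
      unfolding W_def using step by blast
    finally show ?thesis .
  qed
  ultimately have "prob U = 1"
    using erg W C(2) unfolding ergodic_def by force
  then show ?thesis
    using AE_in_set_eq_1[OF U] by (auto simp: U_def elim: eventually_mono)
qed

text \<open>
  Measure preservation turns the measure of a set into an average of visit counts over a window
  of \<open>N\<close> iterates. The two bounds below convert pointwise estimates of the count on a large set
  \<open>K\<close> into estimates of the measure.
\<close>

lemma prob_eq_window_integral: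
  assumes T: "T \<in> M \<rightarrow>\<^sub>M M" "distr M M T = M" and F: "F \<in> events"
  shows "integrable M (\<lambda>x. real (card {i. i < N \<and> (T ^^ i) x \<in> F}))"
    and "real N * prob F = (\<integral>x. real (card {i. i < N \<and> (T ^^ i) x \<in> F}) \<partial>M)"
proof -
  let ?V = "\<lambda>i. (T ^^ i) -` F \<inter> space M"
  have V: "?V i \<in> events" for i
    using measurable_sets[OF measurable_funpow[OF T(1)] F] .
  have card_eq: "real (card {i. i < N \<and> (T ^^ i) x \<in> F}) = (\<Sum>i<N. indicator (?V i) x)"
    if "x \<in> space M" for x
    using that by (auto simp: indicator_def sum.If_cases intro!: arg_cong[where f = card])
  have int: "integrable M (\<lambda>x. \<Sum>i<N. indicator (?V i) x :: real)"
    using V by (intro Bochner_Integration.integrable_sum) (auto simp: emeasure_eq_measure)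
  show "integrable M (\<lambda>x. real (card {i. i < N \<and> (T ^^ i) x \<in> F}))"
    using int by (subst Bochner_Integration.integrable_cong[OF refl card_eq])
  have "(\<integral>x. real (card {i. i < N \<and> (T ^^ i) x \<in> F}) \<partial>M) = (\<integral>x. (\<Sum>i<N. indicator (?V i) x) \<partial>M)"
    by (intro Bochner_Integration.integral_cong card_eq refl)
  also have "\<dots> = (\<Sum>i<N. prob (?V i))"
    using V by (subst Bochner_Integration.integral_sum) (auto simp: emeasure_eq_measure)
  also have "\<dots> = real N * prob F"
    using measure_vimage_funpow[OF T F] by simp
  finally show "real N * prob F = (\<integral>x. real (card {i. i < N \<and> (T ^^ i) x \<in> F}) \<partial>M)"
    by simp
qed

lemma window_count_lower_bound:
  assumes T: "T \<in> M \<rightarrow>\<^sub>M M" "distr M M T = M" and F: "F \<in> events" and K: "K \<in> events"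
    and c: "\<And>x. x \<in> K \<Longrightarrow> c \<le> real (card {i. i < N \<and> (T ^^ i) x \<in> F})"
  shows "c * prob K \<le> real N * prob F"
proof -
  have "c * prob K = (\<integral>x. c * indicator K x \<partial>M)"
    using K by simp
  also have "\<dots> \<le> (\<integral>x. real (card {i. i < N \<and> (T ^^ i) x \<in> F}) \<partial>M)"
  proof (intro integral_mono prob_eq_window_integral(1)[OF T F])
    show "integrable M (\<lambda>x. c * indicator K x)"
      using K by (intro integrable_mult_right) (auto simp: emeasure_eq_measure)
  qed (use c in \<open>auto simp: indicator_def\<close>)
  finally show ?thesis
    using prob_eq_window_integral(2)[OF T F] by simp
qed

lemma window_count_upper_bound:
  assumes T: "T \<in> M \<rightarrow>\<^sub>M M" "distr M M T = M" and F: "F \<in> events" and K: "K \<in> events"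
    and s: "\<And>x. x \<in> K \<Longrightarrow> card {i. i < N \<and> (T ^^ i) x \<in> F} \<le> s"
  shows "real N * prob F \<le> real s + real N * prob (space M - K)"
proof -
  have "card {i. i < N \<and> (T ^^ i) x \<in> F} \<le> N" for x
    using card_mono[of "{..<N}" "{i. i < N \<and> (T ^^ i) x \<in> F}"] by auto
  then have "real (card {i. i < N \<and> (T ^^ i) x \<in> F})
      \<le> real s + real N * indicator (space M - K) x" if "x \<in> space M" for x
    using s[of x] that by (auto simp: indicator_def intro: add_increasing)
  then have "(\<integral>x. real (card {i. i < N \<and> (T ^^ i) x \<in> F}) \<partial>M)
      \<le> (\<integral>x. real s + real N * indicator (space M - K) x \<partial>M)"
    using K by (intro integral_mono prob_eq_window_integral[OF T F])
      (auto simp: emeasure_eq_measure)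
  also have "\<dots> = real s + real N * prob (space M - K)"
    using K by (subst Bochner_Integration.integral_add) (auto simp: emeasure_eq_measure prob_space)
  finally show ?thesis
    using prob_eq_window_integral(2)[OF T F] by simp
qed

end

section \<open>Sets defined by the first hitting time of a small set\<close>

definition hitting_time :: "('a \<Rightarrow> 'a) \<Rightarrow> 'a set \<Rightarrow> 'a \<Rightarrow> nat" where
  "hitting_time T C x = (LEAST j. (T ^^ j) x \<in> C)"

lemma hitting_time_ge:
  assumes "\<exists>j. (T ^^ j) x \<in> C" "\<forall>j<n. (T ^^ j) x \<notin> C"
  shows "n \<le> hitting_time T C x"
  using LeastI_ex[OF assms(1)] assms(2) unfolding hitting_time_def by (meson not_le)

lemma hitting_time_funpow:
  assumes ex: "\<exists>j. (T ^^ j) x \<in> C" and no: "\<forall>j<i. (T ^^ j) x \<notin> C"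
  shows "hitting_time T C ((T ^^ i) x) = hitting_time T C x - i"
  unfolding hitting_time_def[of T C "(T ^^ i) x"]
proof (rule Least_equality)
  have "i \<le> hitting_time T C x"
    by (rule hitting_time_ge[OF ex no])
  then have "(T ^^ (hitting_time T C x - i)) ((T ^^ i) x) = (T ^^ hitting_time T C x) x"
    by (metis comp_apply funpow_add le_add_diff_inverse2)
  then show "(T ^^ (hitting_time T C x - i)) ((T ^^ i) x) \<in> C"
    using LeastI_ex[OF ex] by (simp add: hitting_time_def)
next
  fix j assume "(T ^^ j) ((T ^^ i) x) \<in> C"
  then have "(T ^^ (j + i)) x \<in> C"
    by (simp add: funpow_add)
  then have "hitting_time T C x \<le> j + i"
    unfolding hitting_time_def by (rule Least_le)
  then show "hitting_time T C x - i \<le> j"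
    by simp
qed

text \<open>
  Hitting times run downwards along an orbit, periodic correlations are counted upwards;
  reversing the window passes from one to the other.
\<close>

lemma card_countdown_window:
  fixes N u v :: nat
  assumes "N \<le> u" "N \<le> v"
  shows "card {i. i < N \<and> P (u - i) \<and> Q (v - i)}
       = card {n. n < N \<and> P (n + (u + 1 - N)) \<and> Q (n + (v + 1 - N))}"
proof (rule bij_betw_same_card)
  show "bij_betw (\<lambda>i. N - 1 - i) {i. i < N \<and> P (u - i) \<and> Q (v - i)}
      {n. n < N \<and> P (n + (u + 1 - N)) \<and> Q (n + (v + 1 - N))}"
  proof (rule bij_betwI[where g = "\<lambda>n. N - 1 - n"])
    have "N - 1 - i + (w + 1 - N) = w - i" if "i < N" "N \<le> w" for i w
      using that by arith
    then show "(\<lambda>i. N - 1 - i) \<in> {i. i < N \<and> P (u - i) \<and> Q (v - i)}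
        \<rightarrow> {n. n < N \<and> P (n + (u + 1 - N)) \<and> Q (n + (v + 1 - N))}"
      using assms by simp
    have "w - (N - 1 - n) = n + (w + 1 - N)" if "n < N" "N \<le> w" for n w
      using that by arith
    then show "(\<lambda>n. N - 1 - n) \<in> {n. n < N \<and> P (n + (u + 1 - N)) \<and> Q (n + (v + 1 - N))}
        \<rightarrow> {i. i < N \<and> P (u - i) \<and> Q (v - i)}"
      using assms by simp
  qed auto
qed

text \<open>
  All errors come from points whose orbit meets \<open>C\<close> during the first \<open>N\<close> steps. They have
  measure at most \<open>g = N \<mu>(C)\<close>; the factor two in the last bound appears because the orbits of
  both \<open>x\<close> and \<open>T\<^sup>m x\<close> must avoid \<open>C\<close>. None of the bounds depends on \<open>m\<close>.
\<close>

lemma (in prob_space) hitting_time_set_bounds: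
  fixes P :: "nat \<Rightarrow> bool" and C :: "'a set" and N :: nat
  assumes T: "T \<in> M \<rightarrow>\<^sub>M M" "distr M M T = M"
    and C: "C \<in> events" and hits: "AE x in M. \<exists>j. (T ^^ j) x \<in> C"
    and per: "\<And>n. P (n + N) = P n"
  defines "A \<equiv> {x \<in> space M. P (hitting_time T C x)}"
    and "s \<equiv> card {n. n < N \<and> P n}" and "g \<equiv> real N * prob C"
  shows "A \<in> events"
    and "real N * prob A \<le> real s + real N * g"
    and "real s * (1 - g) \<le> real N * prob A"
    and "\<lbrakk>0 \<le> c; \<And>a b. c \<le> real (card {n. n < N \<and> P (n + a) \<and> P (n + b)})\<rbrakk>
      \<Longrightarrow> c * (1 - 2 * g) \<le> real N * prob (A \<inter> ((T ^^ m) -` A \<inter> space M))"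
proof -
  note [measurable] = measurable_funpow[OF T(1)] C(1)
  have "hitting_time T C \<in> M \<rightarrow>\<^sub>M count_space UNIV"
    unfolding hitting_time_def by measurable
  note [measurable] = this
  show A: "A \<in> events"
    unfolding A_def by measurable
  \<comment> \<open>On \<open>G\<close> the hitting time counts down throughout the window.\<close>
  define G where "G = {x \<in> space M. (\<exists>j. (T ^^ j) x \<in> C) \<and> (\<forall>j<N. (T ^^ j) x \<notin> C)}"
  have G: "G \<in> events"
    unfolding G_def by measurable
  define Z where "Z = {x \<in> space M. \<not> (\<exists>j. (T ^^ j) x \<in> C)}"
  have Z: "Z \<in> events"
    unfolding Z_def by measurable
  have V: "(T ^^ j) -` C \<inter> space M \<in> events" for j
    by measurable
  have "prob Z = 0"
    using hits Z unfolding Z_def by (subst prob_eq_0) (auto elim: eventually_mono)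
  have "prob (space M - G) \<le> prob (Z \<union> (\<Union>j<N. (T ^^ j) -` C \<inter> space M))"
    using Z V by (intro finite_measure_mono) (auto simp: G_def Z_def)
  also have "\<dots> \<le> prob Z + prob (\<Union>j<N. (T ^^ j) -` C \<inter> space M)"
    using Z V by (intro measure_Un_le) auto
  also have "\<dots> \<le> 0 + (\<Sum>j<N. prob ((T ^^ j) -` C \<inter> space M))"
    using \<open>prob Z = 0\<close> V by (intro add_mono finite_measure_subadditive_finite) auto
  also have "\<dots> = g"
    using measure_vimage_funpow[OF T C] by (simp add: g_def)
  finally have Gc: "prob (space M - G) \<le> g" .
  have in_A: "(T ^^ i) x \<in> A \<longleftrightarrow> P (hitting_time T C x - i)" if "x \<in> G" "i < N" for x i
    using that funpow_in_space[OF T(1)] hitting_time_funpow[of T x C i] by (auto simp: A_def G_def)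
  have late: "N \<le> hitting_time T C x" if "x \<in> G" for x
    using that by (auto simp: G_def intro: hitting_time_ge)
  have count: "card {i. i < N \<and> (T ^^ i) x \<in> A} = s" if "x \<in> G" for x
  proof -
    have "{i. i < N \<and> (T ^^ i) x \<in> A} = {i. i < N \<and> P (hitting_time T C x - i) \<and> True}"
      using in_A[OF that] by auto
    then have "card {i. i < N \<and> (T ^^ i) x \<in> A}
        = card {n. n < N \<and> P (n + (hitting_time T C x + 1 - N))}"
      using card_countdown_window[of N "hitting_time T C x" N P "\<lambda>_. True"] late[OF that] by simp
    then show ?thesis
      using card_periodic_shift[of P N, OF per] by (simp add: s_def)
  qed
  have "real N * prob A \<le> real s + real N * prob (space M - G)"
    using count by (intro window_count_upper_bound[OF T A G]) simp
  also have "\<dots> \<le> real s + real N * g"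
    using Gc by (intro add_left_mono mult_left_mono) auto
  finally show "real N * prob A \<le> real s + real N * g" .
  have Gge: "1 - g \<le> prob G"
    using Gc prob_compl[OF G] by simp
  have "real s * (1 - g) \<le> real s * prob G"
    using Gge by (intro mult_left_mono) auto
  also have "\<dots> \<le> real N * prob A"
    using count by (intro window_count_lower_bound[OF T A G]) simp
  finally show "real s * (1 - g) \<le> real N * prob A" .
  assume c0: "0 \<le> c" and c: "\<And>a b. c \<le> real (card {n. n < N \<and> P (n + a) \<and> P (n + b)})"
  define F where "F = A \<inter> ((T ^^ m) -` A \<inter> space M)"
  define K where "K = G \<inter> ((T ^^ m) -` G \<inter> space M)"
  have VG: "(T ^^ m) -` G \<inter> space M \<in> events"
    using measurable_sets[OF measurable_funpow[OF T(1)] G] .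
  have F: "F \<in> events" and K: "K \<in> events"
    using A G VG measurable_sets[OF measurable_funpow[OF T(1)] A] by (auto simp: F_def K_def)
  have "prob (space M - K) \<le> prob ((space M - G) \<union> (space M - ((T ^^ m) -` G \<inter> space M)))"
    using G VG by (intro finite_measure_mono) (auto simp: K_def)
  also have "\<dots> \<le> prob (space M - G) + prob (space M - ((T ^^ m) -` G \<inter> space M))"
    using G VG by (intro measure_Un_le) auto
  also have "\<dots> = 2 * prob (space M - G)"
    using prob_compl[OF G] prob_compl[OF VG] measure_vimage_funpow[OF T G] by simp
  finally have "1 - 2 * g \<le> prob K"
    using Gc prob_compl[OF K] by simp
  then have "c * (1 - 2 * g) \<le> c * prob K"
    using c0 by (intro mult_left_mono)
  also have "\<dots> \<le> real N * prob F"
  proof (rule window_count_lower_bound[OF T F K])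
    fix x assume "x \<in> K"
    then have x: "x \<in> G" "(T ^^ m) x \<in> G" "x \<in> space M"
      by (auto simp: K_def)
    have "(T ^^ i) x \<in> F \<longleftrightarrow> (T ^^ i) x \<in> A \<and> (T ^^ i) ((T ^^ m) x) \<in> A" for i
      using funpow_in_space[OF T(1) x(3)]
      by (auto simp: F_def simp flip: comp_apply[of "T ^^ _" "T ^^ _"] funpow_add)
        (simp_all add: add.commute)
    then have "{i. i < N \<and> (T ^^ i) x \<in> F}
        = {i. i < N \<and> P (hitting_time T C x - i) \<and> P (hitting_time T C ((T ^^ m) x) - i)}"
      using in_A[OF x(1)] in_A[OF x(2)] by auto
    then show "c \<le> real (card {i. i < N \<and> (T ^^ i) x \<in> F})"
      using card_countdown_window[OF late[OF x(1)] late[OF x(2)], of P P] c by simp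
  qed
  finally show "c * (1 - 2 * g) \<le> real N * prob (A \<inter> ((T ^^ m) -` A \<inter> space M))"
    unfolding F_def .
qed

section \<open>Small sets and measurable images\<close>

text \<open>
  A short interval is pulled back through the isomorphism. This gives a set of the completion
  only, which is replaced by a set of the original \<open>\<sigma>\<close>-algebra of the same measure.
\<close>

lemma lebesgue_probability_space_small_set:
  assumes "lebesgue_probability_space M" "\<gamma> > 0"
  shows "\<exists>C \<in> sets M. 0 < measure M C \<and> measure M C < \<gamma>"
proof -
  interpret prob_space M
    using assms(1) by (simp add: lebesgue_probability_space_def)
  let ?L = "lebesgue_on {0..1::real}"
  obtain X0 Y0 f where X0: "X0 \<in> sets (completion M)"
    and Y0: "Y0 \<in> sets ?L" "space ?L - Y0 \<in> null_sets ?L"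
    and f: "f \<in> restrict_space (completion M) X0 \<rightarrow>\<^sub>M restrict_space ?L Y0"
    and distr: "distr (restrict_space (completion M) X0) (restrict_space ?L Y0) f
      = restrict_space ?L Y0"
    using assms(1) unfolding lebesgue_probability_space_def isomorphic_mod_null_def by blast
  define h where "h = min (\<gamma> / 2) (1 / 2)"
  have h: "0 < h" "h < \<gamma>" "h \<le> 1"
    using assms(2) by (auto simp: h_def min_def)
  have I: "{0..h} \<in> sets ?L"
    using h by (subst sets_restrict_space_iff) auto
  have IY: "{0..h} \<inter> Y0 \<in> sets ?L"
    using I Y0(1) by blast
  have IY': "{0..h} \<inter> Y0 \<in> sets (restrict_space ?L Y0)"
    using IY Y0(1) by (subst sets_restrict_space_iff) auto
  have "emeasure ?L ({0..h} \<inter> Y0) = emeasure ?L ({0..h} - (space ?L - Y0))"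
    using h by (intro arg_cong[where f = "emeasure ?L"]) auto
  also have "\<dots> = emeasure ?L {0..h}"
    by (rule emeasure_Diff_null_set[OF Y0(2) I])
  also have "\<dots> = ennreal h"
    using h by (subst emeasure_restrict_space) auto
  finally have "emeasure (restrict_space ?L Y0) ({0..h} \<inter> Y0) = ennreal h"
    using Y0(1) by (subst emeasure_restrict_space) auto
  define D where "D = f -` ({0..h} \<inter> Y0) \<inter> space (restrict_space (completion M) X0)"
  have "D \<in> sets (restrict_space (completion M) X0)"
    unfolding D_def by (rule measurable_sets[OF f IY'])
  then have D: "D \<in> sets (completion M)" "D \<subseteq> X0"
    using X0 sets.sets_into_space[OF X0] by (simp_all add: sets_restrict_space_iff Int_absorb2)
  have "emeasure (completion M) D = emeasure (restrict_space (completion M) X0) D"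
    using D X0 by (subst emeasure_restrict_space) auto
  also have "\<dots> = emeasure (restrict_space ?L Y0) ({0..h} \<inter> Y0)"
    unfolding D_def using emeasure_distr[OF f IY'] distr by simp
  also have "\<dots> = ennreal h" by fact
  finally have "emeasure M (main_part M D) = ennreal h"
    using D by simp
  then have "measure M (main_part M D) = h"
    using h by (simp add: measure_def)
  then show ?thesis
    using h D by (intro bexI[of _ "main_part M D"]) auto
qed

lemma funpow_image_in_sets:
  assumes X0: "X0 \<in> sets M" and bij: "bij_betw T X0 X0"
    and inv: "the_inv_into X0 T \<in> restrict_space M X0 \<rightarrow>\<^sub>M restrict_space M X0"
    and A: "A \<in> sets M" "A \<subseteq> X0"
  shows "(T ^^ n) ` A \<in> sets M \<and> (T ^^ n) ` A \<subseteq> X0"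
proof (induction n)
  case (Suc n)
  define B where "B = (T ^^ n) ` A"
  have B: "B \<in> sets M" "B \<subseteq> X0"
    using Suc by (auto simp: B_def)
  have sp: "space (restrict_space M X0) = X0"
    using X0 by (simp add: space_restrict_space2)
  have "B \<in> sets (restrict_space M X0)"
    using B X0 by (simp add: sets_restrict_space_iff)
  then have "the_inv_into X0 T -` B \<inter> X0 \<in> sets (restrict_space M X0)"
    using measurable_sets[OF inv] unfolding sp by simp
  then have "the_inv_into X0 T -` B \<inter> X0 \<in> sets M"
    using X0 by (simp add: sets_restrict_space_iff)
  moreover have "the_inv_into X0 T -` B \<inter> X0 = T ` B"
  proof (intro equalityI subsetI)
    fix y assume "y \<in> the_inv_into X0 T -` B \<inter> X0"
    then show "y \<in> T ` B"
      using bij f_the_inv_into_f_bij_betw[OF bij, of y] by (intro image_eqI[of _ _ "the_inv_into X0 T y"]) auto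
  next
    fix y assume "y \<in> T ` B"
    then obtain x where x: "x \<in> B" "y = T x" by auto
    then show "y \<in> the_inv_into X0 T -` B \<inter> X0"
      using B bij the_inv_into_f_f[of T X0 x] by (auto simp: bij_betw_def)
  qed
  moreover have "T ` B \<subseteq> X0"
    using B bij by (auto simp: bij_betw_def)
  moreover have "(T ^^ Suc n) ` A = T ` B"
    by (auto simp: B_def)
  ultimately show ?case
    by simp
qed (use A in simp)

section \<open>Over-recurrent sets of small measure\<close>

theorem proposition3p4:
  fixes M :: "'a measure" and T :: "'a \<Rightarrow> 'a" and \<epsilon> :: real
  assumes "lebesgue_probability_space M"
    and "invertible_mpt M T"
    and "ergodic M T"
    and "\<epsilon> > 0"
  shows "\<forall>\<delta>>0. \<exists>A. over_recurrent M T \<epsilon> A \<and> measure M A < \<delta>"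
proof (intro allI impI)
  fix \<delta> :: real assume "\<delta> > 0"
  interpret prob_space M
    using assms(1) by (simp add: lebesgue_probability_space_def)
  obtain X0 where T: "T \<in> M \<rightarrow>\<^sub>M M" "distr M M T = M"
    and X0: "X0 \<in> events" "space M - X0 \<in> null_sets M" "bij_betw T X0 X0"
      "the_inv_into X0 T \<in> restrict_space M X0 \<rightarrow>\<^sub>M restrict_space M X0"
    using assms(2) unfolding invertible_mpt_def by blast
  \<comment> \<open>Capping \<open>\<epsilon>\<close> at one keeps \<open>1 - e\<close> nonnegative, so that an upper bound on the measure
     of \<open>A\<close> bounds the right-hand side.\<close>
  define e where "e = min \<epsilon> 1"
  have e: "0 < e" "e \<le> 1" "e \<le> \<epsilon>"
    using assms(4) by (auto simp: e_def)
  define \<delta>' where "\<delta>' = min \<delta> 1"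
  have \<delta>': "0 < \<delta>'" "\<delta>' \<le> 1" "\<delta>' \<le> \<delta>"
    using \<open>\<delta> > 0\<close> by (auto simp: \<delta>'_def)
  obtain N :: nat and P where N: "N > 0" and per: "\<And>n. P (n + N) = P n"
    and pos: "card {n. n < N \<and> P n} > 0"
    and dens: "real (card {n. n < N \<and> P n}) < \<delta>' * real N"
    and corr: "\<And>a b. (1 - e / 2) * (real (card {n. n < N \<and> P n}))\<^sup>2
            \<le> real (card {n. n < N \<and> P (n + a) \<and> P (n + b)}) * real N"
    using sparse_periodic_set_with_large_correlations[OF \<delta>'(1) half_gt_zero[OF e(1)]] by blast
  define s where "s = card {n. n < N \<and> P n}"
  define d where "d = real s / real N"
  have d: "0 < d" "d < \<delta>'"
    using pos dens N by (auto simp: d_def s_def field_simps)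
  \<comment> \<open>In the limit \<open>g = 0\<close> of an arbitrarily small set \<open>C\<close> the required inequality is strict, as
     \<open>1 - e / 2 > 1 - e\<close>; by continuity it survives for small positive \<open>g\<close>.\<close>
  have lim: "((\<lambda>g. (1 - e / 2) * d\<^sup>2 * (1 - 2 * g) - (1 - e) * (d + g)\<^sup>2)
      \<longlongrightarrow> (1 - e / 2) * d\<^sup>2 * (1 - 2 * 0) - (1 - e) * (d + 0)\<^sup>2) (at_right 0)"
    by (intro tendsto_intros)
  have "0 < (1 - e / 2) * d\<^sup>2 * (1 - 2 * 0) - (1 - e) * (d + 0)\<^sup>2"
    using e d by (simp add: field_simps)
  then have "\<forall>\<^sub>F g in at_right 0. 0 < (1 - e / 2) * d\<^sup>2 * (1 - 2 * g) - (1 - e) * (d + g)\<^sup>2"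
    by (rule order_tendstoD(1)[OF lim])
  moreover have "\<forall>\<^sub>F g in at_right 0. g < min (\<delta>' - d) 1"
    using d by (intro eventually_at_right_less[THEN eventually_mono] eventually_at_rightI[of 0 "min (\<delta>' - d) 1"]) auto
  ultimately have "\<forall>\<^sub>F g in at_right 0.
      0 < (1 - e / 2) * d\<^sup>2 * (1 - 2 * g) - (1 - e) * (d + g)\<^sup>2 \<and> g < min (\<delta>' - d) 1"
    by (rule eventually_conj)
  then obtain g0 where g0: "g0 > 0" "\<And>g. 0 < g \<Longrightarrow> g < g0 \<Longrightarrow>
      0 < (1 - e / 2) * d\<^sup>2 * (1 - 2 * g) - (1 - e) * (d + g)\<^sup>2 \<and> g < min (\<delta>' - d) 1"
    unfolding eventually_at_right_field by auto
  obtain C where C: "C \<in> events" "0 < prob C" "prob C < g0 / real N"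
    using lebesgue_probability_space_small_set[OF assms(1), of "g0 / real N"] g0(1) N by auto
  define g where "g = real N * prob C"
  have g: "0 < g" "g < \<delta>' - d" "g < 1"
    and main: "(1 - e) * (d + g)\<^sup>2 < (1 - e / 2) * d\<^sup>2 * (1 - 2 * g)"
    using g0(2)[of g] C N by (auto simp: g_def field_simps)
  have hits: "AE x in M. \<exists>j. (T ^^ j) x \<in> C"
    by (rule ergodic_AE_hits[OF T assms(3) C(1,2)])
  define A0 where "A0 = {x \<in> space M. P (hitting_time T C x)}"
  note bounds = hitting_time_set_bounds[where P = P and N = N, OF T C(1) hits per, folded A0_def s_def g_def]
  have A0: "A0 \<in> events"
    by (rule bounds(1))
  define c where "c = (1 - e / 2) * (real s)\<^sup>2 / real N"
  have c: "0 \<le> c"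
    using e by (simp add: c_def)
  have c_le: "c \<le> real (card {n. n < N \<and> P (n + a) \<and> P (n + b)})" for a b
    using corr[of a b] N by (simp add: c_def s_def pos_divide_le_eq)
  define A where "A = A0 \<inter> X0"
  have A: "A \<in> events" "A \<subseteq> X0"
    using A0 X0(1) by (auto simp: A_def)
  have AE_X0: "AE x in M. x \<in> X0"
    using AE_not_in[OF X0(2)] AE_space by eventually_elim auto
  have prob_A: "prob A = prob A0"
  proof (rule measure_eq_AE)
    show "AE x in M. x \<in> A \<longleftrightarrow> x \<in> A0"
      using AE_X0 by eventually_elim (auto simp: A_def)
  qed (use A A0 in auto)
  have "real N * prob A \<le> real N * (d + g)"
    using bounds(2) N by (simp add: prob_A d_def distrib_left)
  then have upper: "prob A \<le> d + g"
    using N by simp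
  have "0 < real s * (1 - g)"
    using pos g by (simp add: s_def)
  also note bounds(3)
  finally have A_pos: "0 < prob A"
    by (simp add: prob_A zero_less_mult_iff)
  have "(1 - \<epsilon>) * (prob A)\<^sup>2 \<le> (1 - e) * (prob A)\<^sup>2"
    using e by (intro mult_right_mono) auto
  also have "\<dots> \<le> (1 - e) * (d + g)\<^sup>2"
    using e upper by (intro mult_left_mono power_mono) auto
  also note main
  finally have lower: "(1 - \<epsilon>) * (prob A)\<^sup>2 < (1 - e / 2) * d\<^sup>2 * (1 - 2 * g)" .
  have recur: "(1 - \<epsilon>) * (prob A)\<^sup>2 < prob (A \<inter> ((T ^^ m) -` A \<inter> space M))" for m
  proof -
    have "AE x in M. (T ^^ m) x \<in> X0"
    proof -
      note [measurable] = X0(1)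
      have X0_events: "{x \<in> space M. x \<in> X0} \<in> events"
        by measurable
      have "AE x in distr M M (T ^^ m). x \<in> X0"
        unfolding distr_funpow[OF T] by (rule AE_X0)
      then show ?thesis
        unfolding AE_distr_iff[OF measurable_funpow[OF T(1)] X0_events] .
    qed
    then have eq: "prob (A \<inter> ((T ^^ m) -` A \<inter> space M)) = prob (A0 \<inter> ((T ^^ m) -` A0 \<inter> space M))"
    proof (intro measure_eq_AE)
      show "AE x in M. x \<in> A \<inter> ((T ^^ m) -` A \<inter> space M)
          \<longleftrightarrow> x \<in> A0 \<inter> ((T ^^ m) -` A0 \<inter> space M)"
        using AE_X0 \<open>AE x in M. (T ^^ m) x \<in> X0\<close> by eventually_elim (auto simp: A_def)
    qed (use A A0 measurable_sets[OF measurable_funpow[OF T(1)]] in auto)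
    have "real N * ((1 - e / 2) * d\<^sup>2 * (1 - 2 * g)) = c * (1 - 2 * g)"
      using N by (simp add: c_def d_def power2_eq_square)
    also have "\<dots> \<le> real N * prob (A0 \<inter> ((T ^^ m) -` A0 \<inter> space M))"
      by (rule bounds(4)[OF c c_le])
    finally have "(1 - e / 2) * d\<^sup>2 * (1 - 2 * g) \<le> prob (A \<inter> ((T ^^ m) -` A \<inter> space M))"
      using N by (simp add: eq)
    with lower show ?thesis
      by linarith
  qed
  have "int_iterate M T n A \<in> events \<and> (1 - \<epsilon>) * (prob A)\<^sup>2 < prob (int_iterate M T n A \<inter> A)" for n
  proof (cases "n \<ge> 0")
    case True
    define m where "m = nat n"
    have it: "int_iterate M T n A = (T ^^ m) ` A"
      using True by (simp add: int_iterate_def m_def)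
    have img: "(T ^^ m) ` A \<in> events"
      using funpow_image_in_sets[OF X0(1,3,4) A] by blast
    then have B: "(T ^^ m) ` A \<inter> A \<in> events"
      using A by blast
    \<comment> \<open>A point of \<open>A\<close> whose \<open>m\<close>-th iterate is in \<open>A\<close> is mapped into both \<open>T\<^sup>m A\<close> and \<open>A\<close>.\<close>
    have "prob (A \<inter> ((T ^^ m) -` A \<inter> space M)) \<le> prob ((T ^^ m) -` ((T ^^ m) ` A \<inter> A) \<inter> space M)"
      using measurable_sets[OF measurable_funpow[OF T(1)] B] by (intro finite_measure_mono) auto
    also have "\<dots> = prob ((T ^^ m) ` A \<inter> A)"
      by (rule measure_vimage_funpow[OF T B])
    finally show ?thesis
      using recur[of m] img by (simp add: it)
  next
    case False
    then have "int_iterate M T n A = (T ^^ nat (- n)) -` A \<inter> space M"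
      by (simp add: int_iterate_def)
    then show ?thesis
      using recur[of "nat (- n)"] measurable_sets[OF measurable_funpow[OF T(1)] A(1)]
      by (simp add: Int_commute)
  qed
  then have "over_recurrent M T \<epsilon> A"
    using A A_pos upper g \<delta>' unfolding over_recurrent_def by auto
  moreover have "prob A < \<delta>"
    using upper g \<delta>' by linarith
  ultimately show "\<exists>A. over_recurrent M T \<epsilon> A \<and> prob A < \<delta>"
    by blast
qed

end
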